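(* Let $A$ be a finite set, let $m\ge1$ and let $\mu$ and $\nu$ be exchangeable laws on $A^m$. If $\nu$ is Lorentzian, then $$D(\mu_1\Vert\nu_1)\ \le\ \frac1m\,D(\mu\Vert\nu).$$
   Context: A law is a probability measure on a finite set. A law on $A^m$ is exchangeable if it is invariant under permutations of the $m$ coordinate positions. $\mu_1$ denotes the first one-coordinate marginal of $\mu$, i.e. the law of $X_1$ when $(X_1,\dots,X_m)\sim\mu$. Relative entropy (natural logarithm, $0\log0=0\log(0/0)=0$): $D(\mu\Vert\nu)=\sum_\omega\mu(\omega)\log\frac{\mu(\omega)}{\nu(\omega)}$ if $\mu\ll\nu$ (i.e. $\nu(\omega)=0$ implies $\mu(\omega)=0$), and $D(\mu\Vert\nu)=+\infty$ otherwise. For $\boldsymbol\omega\in A^m$, the count vector is $T(\boldsymbol\omega)=(|\{j\in[m]:\omega_j=a\}|:a\in A)\in\mathbb{N}_0^A$. The count-generating polynomial of a law $\mu$ on $A^m$ is $h_\mu(\mathbf x)=\mathbb{E}_{X\sim\mu}\,\mathbf x^{T(X)}$, where $\mathbf x^{\mathbf n}=\prod_{a\in A}x_a^{n_a}$. A law $\mu$ on $A^m$ is called Lorentzian if $h_\mu$ is a Lorentzian polynomial. Lorentzian polynomials: a symmetric entrywise-nonnegative matrix is antiferromagnetic if it has at most one positive eigenvalue counted with multiplicity. A set $S\subseteq\mathbb{N}_0^I$ ($I$ finite) is M-convex if for all $\boldsymbol\alpha,\boldsymbol\beta\in S$ and $\sigma\in I$ with $\alpha_\sigma>\beta_\sigma$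 there is $\tau\in I$ with $\alpha_\tau<\beta_\tau$, $\boldsymbol\alpha-\mathbf e_\sigma+\mathbf e_\tau\in S$ and $\boldsymbol\beta-\mathbf e_\tau+\mathbf e_\sigma\in S$, where $\mathbf e_\sigma$ are the standard unit vectors. The support of a polynomial is the set of exponents of monomials with nonzero coefficient. A polynomial $f\in\mathbb{R}_{\ge0}[x_\sigma:\sigma\in I]$ of degree $d$ is Lorentzian if either $f$ is a constant, or $d\ge1$ and: (1) $f$ is homogeneous with M-convex support; (2) if $d=2$, the Hessian $\nabla^2f$ is antiferromagnetic; (3) if $d\ge3$, for each $\sigma\in I$ the partial derivative $\partial_\sigma f$ is either zero or Lorentzian (recursively). *)

theory Defs
  imports
    "HOL-Probability.Probability_Mass_Function"
    "HOL-Library.Poly_Mapping"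
    "HOL-Combinatorics.Permutations"
begin

text \<open>
  The finite set \<open>A\<close> is the universe of a type of class \<^class>\<open>finite\<close>. Elements of \<open>A\<^sup>m\<close> are the
  lists of length \<open>m\<close>, with positions numbered from \<open>0\<close>. Real polynomials in the variables
  \<open>x\<^sub>a\<close> with \<open>a \<in> A\<close> are finitely supported maps from exponent vectors to coefficients.
\<close>

type_synonym 'a rpoly = "('a \<Rightarrow>\<^sub>0 nat) \<Rightarrow>\<^sub>0 real"

definition law_on_power :: "nat \<Rightarrow> 'a::finite list pmf \<Rightarrow> bool" where
  "law_on_power m \<mu> \<longleftrightarrow> set_pmf \<mu> \<subseteq> {w. length w = m}"

definition exchangeable :: "nat \<Rightarrow> 'a::finite list pmf \<Rightarrow> bool" where
  "exchangeable m \<mu> \<longleftrightarrow> (\<forall>\<pi>. \<pi> permutes {..<m} \<longrightarrow> map_pmf (permute_list \<pi>) \<mu> = \<mu>)"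

definition first_marginal :: "'a list pmf \<Rightarrow> 'a pmf" where
  "first_marginal \<mu> = map_pmf hd \<mu>"

text \<open>
  For laws of finite support only. Summing over the support of \<open>\<mu>\<close> implements \<open>0 log 0 = 0\<close>
  and \<open>0 log (0/0) = 0\<close>.
\<close>

definition rel_entropy :: "'b pmf \<Rightarrow> 'b pmf \<Rightarrow> ereal" where
  "rel_entropy \<mu> \<nu> =
     (if \<forall>w. pmf \<nu> w = 0 \<longrightarrow> pmf \<mu> w = 0
      then ereal (\<Sum>w\<in>set_pmf \<mu>. pmf \<mu> w * ln (pmf \<mu> w / pmf \<nu> w))
      else \<infinity>)"

lift_definition count_vector :: "'a::finite list \<Rightarrow> ('a \<Rightarrow>\<^sub>0 nat)"
  is "\<lambda>w a. card {j. j < length w \<and> w ! j = a}"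
  by simp

definition count_gen_poly :: "'a::finite list pmf \<Rightarrow> 'a rpoly" where
  "count_gen_poly \<mu> = (\<Sum>w\<in>set_pmf \<mu>. Poly_Mapping.single (count_vector w) (pmf \<mu> w))"

definition monom_degree :: "('a::finite \<Rightarrow>\<^sub>0 nat) \<Rightarrow> nat" where
  "monom_degree n = (\<Sum>a\<in>UNIV. Poly_Mapping.lookup n a)"

text \<open>The zero polynomial gets degree \<open>0\<close>.\<close>

definition total_degree :: "'a::finite rpoly \<Rightarrow> nat" where
  "total_degree f = Max (insert 0 (monom_degree ` Poly_Mapping.keys f))"

definition homogeneous :: "'a::finite rpoly \<Rightarrow> bool" where
  "homogeneous f \<longleftrightarrow> (\<forall>n\<in>Poly_Mapping.keys f. monom_degree n = total_degree f)"

text \<open>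
  In a term with \<open>n\<^sub>a = 0\<close> the exponent subtraction is truncated, but its coefficient vanishes.
\<close>

definition partial_deriv :: "'a::finite \<Rightarrow> 'a rpoly \<Rightarrow> 'a rpoly" where
  "partial_deriv a f =
     (\<Sum>n\<in>Poly_Mapping.keys f. Poly_Mapping.single (n - Poly_Mapping.single a 1)
        (real (Poly_Mapping.lookup n a) * Poly_Mapping.lookup f n))"

definition M_convex :: "('a::finite \<Rightarrow>\<^sub>0 nat) set \<Rightarrow> bool" where
  "M_convex S \<longleftrightarrow>
     (\<forall>\<alpha>\<in>S. \<forall>\<beta>\<in>S. \<forall>\<sigma>. Poly_Mapping.lookup \<alpha> \<sigma> > Poly_Mapping.lookup \<beta> \<sigma> \<longrightarrow>
        (\<exists>\<tau>. Poly_Mapping.lookup \<alpha> \<tau> < Poly_Mapping.lookup \<beta> \<tau> \<and>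
             \<alpha> - Poly_Mapping.single \<sigma> 1 + Poly_Mapping.single \<tau> 1 \<in> S \<and>
             \<beta> - Poly_Mapping.single \<tau> 1 + Poly_Mapping.single \<sigma> 1 \<in> S))"

text \<open>Only used for \<open>f\<close> of degree two, where the second partial derivatives are constants.\<close>

definition hessian :: "'a::finite rpoly \<Rightarrow> real^'a^'a" where
  "hessian f = (\<chi> \<sigma> \<tau>. Poly_Mapping.lookup (partial_deriv \<sigma> (partial_deriv \<tau> f)) 0)"

definition eigenspace :: "real^'n^'n \<Rightarrow> real \<Rightarrow> (real^'n) set" where
  "eigenspace H l = {v. H *v v = l *\<^sub>R v}"

definition pos_eigenvalues :: "real^'n^'n \<Rightarrow> real set" where
  "pos_eigenvalues H = {l. l > 0 \<and> (\<exists>v. v \<noteq> 0 \<and> v \<in> eigenspace H l)}"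

text \<open>
  The sum in the definition of \<open>antiferromagnetic\<close> below is over a finite set, hence not
  trivially zero.
\<close>

lemma finite_pos_eigenvalues:
  fixes H :: "real^'n^'n"
  assumes "transpose H = H"
  shows "finite (pos_eigenvalues H)"
proof -
  have "\<forall>l\<in>pos_eigenvalues H. \<exists>v. v \<noteq> 0 \<and> H *v v = l *\<^sub>R v"
    by (auto simp: pos_eigenvalues_def eigenspace_def)
  then obtain v where v: "\<And>l. l \<in> pos_eigenvalues H \<Longrightarrow> v l \<noteq> 0 \<and> H *v v l = l *\<^sub>R v l"
    by metis
  have orth: "v k \<bullet> v l = 0"
    if "k \<in> pos_eigenvalues H" "l \<in> pos_eigenvalues H" "k \<noteq> l" for k l
  proof -
    have "v k \<bullet> (H *v v l) = (H *v v k) \<bullet> v l"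
      by (metis assms dot_lmul_matrix vector_transpose_matrix)
    then have "l * (v k \<bullet> v l) = k * (v k \<bullet> v l)"
      using v that by simp
    then show ?thesis using that(3) by simp
  qed
  have inj: "inj_on v (pos_eigenvalues H)"
    by (rule inj_onI) (metis inner_eq_zero_iff orth v)
  have "pairwise orthogonal (v ` pos_eigenvalues H)"
    unfolding pairwise_def orthogonal_def using orth by auto
  then have "finite (v ` pos_eigenvalues H)"
    by (rule pairwise_orthogonal_imp_finite)
  then show ?thesis using inj finite_imageD by blast
qed

text \<open>
  The multiplicity of an eigenvalue is the dimension of its eigenspace; for a real symmetric
  matrix this is also its multiplicity as a root of the characteristic polynomial.
\<close>

definition antiferromagnetic :: "real^'n^'n \<Rightarrow> bool" where
  "antiferromagnetic H \<longleftrightarrow>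
     transpose H = H \<and> (\<forall>i j. H $ i $ j \<ge> 0) \<and>
     (\<Sum>l\<in>pos_eigenvalues H. dim (eigenspace H l)) \<le> 1"

text \<open>
  The recursion on the degree is rendered as an inductive predicate: partial derivatives of a
  polynomial of positive degree have smaller degree.
\<close>

inductive lorentzian :: "'a::finite rpoly \<Rightarrow> bool" where
  lorentzian_const:
    "\<lbrakk>\<forall>n. Poly_Mapping.lookup f n \<ge> 0; total_degree f = 0\<rbrakk> \<Longrightarrow> lorentzian f"
| lorentzian_pos_degree:
    "\<lbrakk>\<forall>n. Poly_Mapping.lookup f n \<ge> 0; total_degree f \<ge> 1;
      homogeneous f; M_convex (Poly_Mapping.keys f);
      total_degree f = 2 \<longrightarrow> antiferromagnetic (hessian f);
      total_degree f \<ge> 3 \<longrightarrow> (\<forall>\<sigma>. partial_deriv \<sigma> f = 0 \<or> lorentzian (partial_deriv \<sigma> f))\<rbrakk>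
     \<Longrightarrow> lorentzian f"

definition lorentzian_law :: "'a::finite list pmf \<Rightarrow> bool" where
  "lorentzian_law \<mu> \<longleftrightarrow> lorentzian (count_gen_poly \<mu>)"

end

theory Submission
  imports Defs
begin

text \<open>
  Let \<open>h\<close> be the count-generating polynomial of \<open>\<nu>\<close> and \<open>p, q\<close> the first marginals. By the
  Donsker--Varadhan principle, tested with \<open>\<omega> \<mapsto> \<Sum>\<^sub>j ln (p / q)(\<omega>\<^sub>j)\<close>, it suffices that
  \<open>h (p / q) \<le> 1\<close>. A Lorentzian polynomial is log-concave on the positive orthant, and \<open>ln h\<close> is
  stationary at \<open>1\<close> in the direction \<open>p / q - 1\<close> because \<open>\<nabla>h(1) = m q\<close>; as \<open>h(1) = 1\<close>, the bound
  follows.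

  Log-concavity comes from the sharper inequality
  \<open>d f(x) D\<^sub>v\<^sup>2f(x) \<le> (d - 1) (D\<^sub>vf(x))\<^sup>2\<close>, \<open>d = deg f\<close>, proved by induction on the degree.
  By Euler's identity, the inequalities for all \<open>\<partial>\<^sub>if\<close> add up to a spectral gap for the rescaled
  Hessian of \<open>f\<close>, while M-convexity of the support makes its Perron eigenvalue simple.
\<close>

section \<open>Symmetric matrices with one positive eigenvalue\<close>

lemma symmetric_matrix_inner:
  fixes B :: "real^'n^'n"
  assumes "transpose B = B"
  shows "v \<bullet> (B *v w) = (B *v v) \<bullet> w"
  by (metis assms dot_lmul_matrix vector_transpose_matrix)

text \<open>The Rayleigh quotient attains its maximum on the compact unit sphere of
  \<open>V\<close>, and a maximiser is an eigenvector: invariance of \<open>V\<close> keeps the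
  residual of the eigenvalue equation inside \<open>V\<close>, where it serves as a direction of
  variation.\<close>

lemma symmetric_eigenvector_in_subspace:
  fixes B :: "real^'n^'n"
  assumes sym: "transpose B = B" and V: "subspace V" and inv: "\<And>v. v \<in> V \<Longrightarrow> B *v v \<in> V"
    and v: "v \<in> V" "v \<bullet> (B *v v) > 0"
  obtains w l where "w \<in> V" "w \<noteq> 0" "l > 0" "B *v w = l *\<^sub>R w"
proof -
  let ?K = "sphere 0 1 \<inter> V"
  have "v \<noteq> 0" using v by auto
  have "compact ?K" by (intro compact_Int_closed compact_sphere closed_subspace V)
  moreover have "(1 / norm v) *\<^sub>R v \<in> ?K" using V v \<open>v \<noteq> 0\<close> by (simp add: subspace_scale)
  moreover have "continuous_on ?K (\<lambda>w. w \<bullet> (B *v w))"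
    by (intro continuous_intros matrix_vector_mult_linear_continuous_on)
  ultimately obtain w where w: "w \<in> ?K" and max: "\<And>y. y \<in> ?K \<Longrightarrow> y \<bullet> (B *v y) \<le> w \<bullet> (B *v w)"
    using continuous_attains_sup[of ?K "\<lambda>w. w \<bullet> (B *v w)"] by blast
  define l where "l = w \<bullet> (B *v w)"
  have ww: "w \<bullet> w = 1" "w \<in> V" using w by (auto simp: dot_square_norm)
  have bound: "u \<bullet> (B *v u) \<le> l * (u \<bullet> u)" if "u \<in> V" for u
  proof (cases "u = 0")
    case False
    then have "(1 / norm u) *\<^sub>R u \<in> ?K" using V that by (simp add: subspace_scale)
    from max[OF this] have "(u \<bullet> (B *v u)) / (norm u)\<^sup>2 \<le> l"
      by (simp add: matrix_vector_mult_scaleR l_def power2_eq_square)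
    then show ?thesis using False by (simp add: pos_divide_le_eq dot_square_norm)
  qed simp
  have "0 < l * (v \<bullet> v)" using bound[OF v(1)] v(2) by linarith
  then have l: "l > 0" using \<open>v \<noteq> 0\<close> by (metis inner_gt_zero_iff zero_less_mult_pos2)
  define z where "z = l *\<^sub>R w - B *v w"
  have zV: "z \<in> V" unfolding z_def using V inv ww by (simp add: subspace_diff subspace_scale)
  define c where "c = l * (z \<bullet> z) - z \<bullet> (B *v z)"
  define b where "b = z \<bullet> z"
  have c: "c \<ge> 0" using bound[OF zV] by (simp add: c_def)
  have zw: "l * (w \<bullet> z) - z \<bullet> (B *v w) = b"
    unfolding b_def by (subst (3) z_def) (simp add: inner_simps inner_commute)
  \<comment> \<open>First variation at the maximiser: \<open>bound\<close> at
    \<open>w + t z\<close>. Since this holds for both signs of \<open>t\<close>, the linear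
    coefficient \<open>b\<close>, the squared norm of the residual \<open>z\<close>, must
    vanish.\<close>
  have *: "0 \<le> t\<^sup>2 * c + 2 * t * b" for t
  proof -
    have "w + t *\<^sub>R z \<in> V" using V ww zV by (simp add: subspace_add subspace_scale)
    from bound[OF this]
    have "w \<bullet> (B *v w) + t * (w \<bullet> (B *v z)) + t * (z \<bullet> (B *v w)) + t\<^sup>2 * (z \<bullet> (B *v z))
       \<le> l * (1 + 2 * t * (w \<bullet> z) + t\<^sup>2 * (z \<bullet> z))"
      using ww by (simp add: matrix_vector_right_distrib matrix_vector_mult_scaleR inner_simps
          inner_commute algebra_simps power2_eq_square)
    moreover have "w \<bullet> (B *v z) = z \<bullet> (B *v w)"
      using symmetric_matrix_inner[OF sym] by (simp add: inner_commute)
    ultimately have "t\<^sup>2 * c + 2 * t * (l * (w \<bullet> z) - z \<bullet> (B *v w)) \<ge> 0"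
      unfolding c_def l_def[symmetric] by (simp add: algebra_simps)
    then show ?thesis using zw by simp
  qed
  have "b = 0"
  proof (rule ccontr)
    \<comment> \<open>The denominator \<open>c + 1\<close> is positive even for
      \<open>c = 0\<close>, and \<open>t c + 2 b = b (c + 2) / (c + 1)\<close>.\<close>
    define t where "t = - b / (c + 1)"
    assume "b \<noteq> 0"
    then have b: "b > 0" by (simp add: b_def)
    then have "t < 0" "t * c + 2 * b > 0"
      using c by (auto simp: t_def field_simps add_nonneg_pos)
    then have "t * (t * c + 2 * b) < 0" by (rule mult_neg_pos)
    with *[of t] show False by (simp add: algebra_simps power2_eq_square)
  qed
  then have "B *v w = l *\<^sub>R w" by (simp add: b_def z_def)
  with ww l that show ?thesis by force
qed

text \<open>With a single positive eigenvector \<open>u\<close>, the form is nonpositive on the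
  hyperplane orthogonal to \<open>u\<close>. Moving \<open>v\<close> along \<open>x\<close> into
  that hyperplane and completing the square gives the claim.\<close>

lemma antiferromagnetic_reverse_Cauchy_Schwarz:
  fixes H :: "real^'n^'n"
  assumes H: "antiferromagnetic H" and x: "x \<bullet> (H *v x) \<ge> 0"
  shows "(v \<bullet> (H *v v)) * (x \<bullet> (H *v x)) \<le> (v \<bullet> (H *v x))\<^sup>2"
proof (cases "x \<bullet> (H *v x) = 0")
  case False
  have sym: "transpose H = H" using H by (simp add: antiferromagnetic_def)
  obtain u k where u: "u \<noteq> 0" "k > 0" "H *v u = k *\<^sub>R u"
    using symmetric_eigenvector_in_subspace[OF sym subspace_UNIV, of x] x False by auto
  \<comment> \<open>\<open>H\<close> preserves the hyperplane, so a positive value there would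
    produce a second positive eigenvector \<open>w\<close> orthogonal to \<open>u\<close>. Whether
    or not its eigenvalue equals \<open>k\<close>, the multiplicities would then add up to at least
    two.\<close>
  have neg: "v \<bullet> (H *v v) \<le> 0" if uv: "u \<bullet> v = 0" for v
  proof (rule ccontr)
    assume "\<not> v \<bullet> (H *v v) \<le> 0"
    moreover have "u \<bullet> (H *v v) = 0" if "u \<bullet> v = 0" for v
      using u that by (simp add: symmetric_matrix_inner[OF sym])
    ultimately obtain w l where w: "u \<bullet> w = 0" "w \<noteq> 0" "l > 0" "H *v w = l *\<^sub>R w"
      using symmetric_eigenvector_in_subspace[OF sym subspace_hyperplane[of u], of v] uv by auto
    have kl: "k \<in> pos_eigenvalues H" "l \<in> pos_eigenvalues H"
      using u w by (auto simp: pos_eigenvalues_def eigenspace_def)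
    have mem: "u \<in> eigenspace H k" "w \<in> eigenspace H l"
      using u w by (auto simp: eigenspace_def)
    have dim_pos: "dim (eigenspace H j) \<ge> card S" if "S \<subseteq> eigenspace H j" "independent S" for S j
      using that by (metis dim_eq_card dim_subset dim_span)
    have fin: "finite (pos_eigenvalues H)" by (rule finite_pos_eigenvalues[OF sym])
    have "2 \<le> (\<Sum>j\<in>pos_eigenvalues H. dim (eigenspace H j))"
    proof (cases "k = l")
      case True
      have "u \<noteq> w" using w u by auto
      have "independent {u, w}"
      proof (rule pairwise_orthogonal_independent)
        show "pairwise orthogonal {u, w}"
          using w by (auto simp: pairwise_def orthogonal_def inner_commute)
      qed (use u w in auto)
      from dim_pos[OF _ this, of k] mem True \<open>u \<noteq> w\<close> have "2 \<le> dim (eigenspace H k)" by auto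
      also have "\<dots> \<le> (\<Sum>j\<in>pos_eigenvalues H. dim (eigenspace H j))"
        using kl fin by (intro member_le_sum) auto
      finally show ?thesis .
    next
      case False
      have "1 \<le> dim (eigenspace H k)" "1 \<le> dim (eigenspace H l)"
        using dim_pos[of "{u}" k] dim_pos[of "{w}" l] mem u w by auto
      then have "2 \<le> (\<Sum>j\<in>{k,l}. dim (eigenspace H j))" using False by simp
      also have "\<dots> \<le> (\<Sum>j\<in>pos_eigenvalues H. dim (eigenspace H j))"
        using kl fin by (intro sum_mono2) auto
      finally show ?thesis .
    qed
    then show False using H by (simp add: antiferromagnetic_def)
  qed
  have ux: "u \<bullet> x \<noteq> 0" using neg[of x] x False by auto
  define c where "c = (u \<bullet> v) / (u \<bullet> x)"
  have "u \<bullet> (v - c *\<^sub>R x) = 0" using ux by (simp add: c_def inner_simps)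
  from neg[OF this] have "v \<bullet> (H *v v) - 2 * c * (v \<bullet> (H *v x)) + c\<^sup>2 * (x \<bullet> (H *v x)) \<le> 0"
    using symmetric_matrix_inner[OF sym, of x v]
    by (simp add: matrix_vector_mult_diff_distrib matrix_vector_mult_scaleR inner_simps
        inner_commute algebra_simps power2_eq_square)
  then have "(v \<bullet> (H *v v) - 2 * c * (v \<bullet> (H *v x)) + c\<^sup>2 * (x \<bullet> (H *v x))) * (x \<bullet> (H *v x)) \<le> 0"
    using x by (simp add: mult_nonpos_nonneg)
  \<comment> \<open>This square absorbs the terms in \<open>c\<close> of the preceding
    inequality.\<close>
  moreover have "0 \<le> (v \<bullet> (H *v x) - c * (x \<bullet> (H *v x)))\<^sup>2" by simp
  ultimately show ?thesis by (simp add: algebra_simps power2_eq_square)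
qed simp

text \<open>Expand the squares and use symmetry. With \<open>D = diag ((M x)_i / x_i)\<close> the
  right side is twice the quadratic form of \<open>D - M\<close> at \<open>z\<close>. For
  nonnegative \<open>M\<close> this form is therefore nonnegative, and it vanishes only if
  \<open>z / x\<close> agrees at \<open>i\<close> and \<open>j\<close> whenever
  \<open>M $ i $ j > 0\<close>.\<close>

lemma symmetric_quadratic_gap:
  fixes M :: "real^'n^'n" and x z :: "real^'n"
  assumes sym: "transpose M = M" and x: "\<And>i. x $ i > 0"
  shows "(\<Sum>i\<in>UNIV. \<Sum>j\<in>UNIV. M $ i $ j * x $ i * x $ j * (z $ i / x $ i - z $ j / x $ j)\<^sup>2)
     = 2 * ((\<Sum>i\<in>UNIV. (M *v x) $ i / x $ i * (z $ i)\<^sup>2) - z \<bullet> (M *v z))"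
proof -
  have M: "M $ i $ j = M $ j $ i" for i j
    by (metis sym transpose_def vec_lambda_beta)
  let ?f = "\<lambda>i j. M $ i $ j * x $ j / x $ i * (z $ i)\<^sup>2"
  have "(\<Sum>i\<in>UNIV. \<Sum>j\<in>UNIV. M $ i $ j * x $ i * x $ j * (z $ i / x $ i - z $ j / x $ j)\<^sup>2)
     = (\<Sum>i\<in>UNIV. \<Sum>j\<in>UNIV. ?f i j + ?f j i - 2 * (z $ i * (M $ i $ j * z $ j)))"
    using x M by (intro sum.cong refl)
      (simp add: field_simps power2_eq_square less_imp_neq[THEN not_sym])
  also have "\<dots> = (\<Sum>i\<in>UNIV. \<Sum>j\<in>UNIV. ?f i j) + (\<Sum>i\<in>UNIV. \<Sum>j\<in>UNIV. ?f j i)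
      - 2 * (\<Sum>i\<in>UNIV. \<Sum>j\<in>UNIV. z $ i * (M $ i $ j * z $ j))"
    by (simp add: sum.distrib sum_subtractf sum_distrib_left)
  also have "(\<Sum>i\<in>UNIV. \<Sum>j\<in>UNIV. ?f j i) = (\<Sum>i\<in>UNIV. \<Sum>j\<in>UNIV. ?f i j)"
    by (rule sum.swap)
  also have "(\<Sum>i\<in>UNIV. \<Sum>j\<in>UNIV. z $ i * (M $ i $ j * z $ j)) = z \<bullet> (M *v z)"
    by (simp add: inner_vec_def matrix_vector_mult_def sum_distrib_left)
  also have "(\<Sum>i\<in>UNIV. \<Sum>j\<in>UNIV. ?f i j) = (\<Sum>i\<in>UNIV. (M *v x) $ i / x $ i * (z $ i)\<^sup>2)"
    by (simp add: matrix_vector_mult_def sum_distrib_right sum_divide_distrib)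
  finally show ?thesis by simp
qed

text \<open>
  With \<open>D = diag ((M x)\<^sub>i / x\<^sub>i)\<close> and \<open>B = D\<^sup>-\<^sup>1\<^sup>/\<^sup>2 M D\<^sup>-\<^sup>1\<^sup>/\<^sup>2\<close> the hypothesis \<open>key\<close> says \<open>B \<le> B\<^sup>2\<close>, so
  no eigenvalue of \<open>B\<close> lies strictly between \<open>0\<close> and \<open>1\<close>. The vector \<open>D\<^sup>1\<^sup>/\<^sup>2 x\<close> is the Perron vector of
  \<open>B\<close>, with eigenvalue \<open>1\<close>, which is simple by the connectivity hypothesis \<open>conn\<close>.
\<close>

lemma reverse_Cauchy_Schwarz_of_trickle_down:
  fixes M :: "real^'n^'n" and x v :: "real^'n"
  assumes sym: "transpose M = M" and nonneg: "\<And>i j. M $ i $ j \<ge> 0" and x: "\<And>i. x $ i > 0"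
    and key: "\<And>v. v \<bullet> (M *v v) \<le> (\<Sum>i\<in>UNIV. x $ i * ((M *v v) $ i)\<^sup>2 / (M *v x) $ i)"
    and conn: "\<And>S i j. i \<in> S \<Longrightarrow> (M *v x) $ i > 0 \<Longrightarrow> (M *v x) $ j > 0 \<Longrightarrow>
        (\<And>k l. k \<in> S \<Longrightarrow> M $ k $ l > 0 \<Longrightarrow> l \<in> S) \<Longrightarrow> j \<in> S"
  shows "(v \<bullet> (M *v v)) * (x \<bullet> (M *v x)) \<le> (v \<bullet> (M *v x))\<^sup>2"
proof -
  have M: "M $ i $ j = M $ j $ i" for i j
    by (metis sym transpose_def vec_lambda_beta)
  have Mx: "(M *v x) $ i \<ge> 0" for i
    using nonneg x by (simp add: matrix_vector_mult_def sum_nonneg less_imp_le)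
  define d where "d i = (M *v x) $ i / x $ i" for i
  have d: "d i \<ge> 0" for i using Mx x by (simp add: d_def less_imp_le)
  have dx: "d i * x $ i = (M *v x) $ i" for i
    using x[of i] by (simp add: d_def)
  have d0: "M $ i $ j = 0" if "d i = 0" for i j
  proof -
    have "(\<Sum>j\<in>UNIV. M $ i $ j * x $ j) = 0"
      using that x[of i] by (simp add: d_def matrix_vector_mult_def)
    then have "M $ i $ j * x $ j = 0"
      using nonneg x by (subst (asm) sum_nonneg_eq_0_iff) (auto simp: less_imp_le)
    then show ?thesis using x[of j] by simp
  qed
  \<comment> \<open>As \<open>1 / 0 = 0\<close>, this is a pseudo-inverse of
    \<open>sqrt (d i)\<close>. Nothing is lost where \<open>d i = 0\<close>, because by
    \<open>d0\<close> the row of \<open>M\<close> vanishes there; \<open>rM\<close> and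
    \<open>Mr\<close> express this.\<close>
  define r where "r i = 1 / sqrt (d i)" for i
  define B :: "real^'n^'n" where "B = (\<chi> i j. r i * M $ i $ j * r j)"
  have rM: "sqrt (d i) * r i * (M *v y) $ i = (M *v y) $ i" for i y
    using d0[of i] d[of i] by (cases "d i = 0") (auto simp: r_def matrix_vector_mult_def)
  have Mr: "M $ i $ j * (r j * sqrt (d j)) = M $ i $ j" for i j
    using d0[of j i] d[of j] M[of i j] by (cases "d j = 0") (auto simp: r_def)
  have symB: "transpose B = B"
    using M by (simp add: B_def transpose_def vec_eq_iff mult.commute mult.left_commute)
  define s :: "real^'n" where "s = (\<chi> i. sqrt (d i) * x $ i)"
  have Bw: "(B *v w) $ i = r i * (M *v (\<chi> j. r j * w $ j)) $ i" for w i
    by (simp add: B_def matrix_vector_mult_def sum_distrib_left mult.assoc)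
  have scale: "M *v (\<chi> j. r j * (sqrt (d j) * y $ j)) = M *v y" for y
  proof -
    have eq: "M $ i $ j * (r j * (sqrt (d j) * y $ j)) = M $ i $ j * y $ j" for i j y
      by (metis Mr mult.assoc)
    show ?thesis by (simp add: matrix_vector_mult_def vec_eq_iff eq)
  qed
  have Bs: "B *v s = s"
  proof -
    have "(B *v s) $ i = s $ i" for i
    proof -
      have "(B *v s) $ i = r i * (M *v x) $ i"
        using scale[of x] by (simp add: Bw s_def)
      also have "\<dots> = s $ i"
        using dx[of i] d[of i] by (cases "d i = 0") (auto simp: r_def s_def field_simps dx[symmetric])
      finally show ?thesis .
    qed
    then show ?thesis by (simp add: vec_eq_iff)
  qed
  \<comment> \<open>A counterexample yields an eigenvector \<open>w\<close> of \<open>B\<close> with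
    positive eigenvalue \<open>l\<close>, orthogonal to the Perron vector \<open>s\<close>. Then
    \<open>l \<ge> 1\<close>, which forces \<open>w\<close> to be a multiple of \<open>s\<close>, a
    contradiction.\<close>
  have neg: "v \<bullet> (M *v v) \<le> 0" if vx: "v \<bullet> (M *v x) = 0" for v
  proof (rule ccontr)
    assume pos: "\<not> v \<bullet> (M *v v) \<le> 0"
    define u :: "real^'n" where "u = (\<chi> i. sqrt (d i) * v $ i)"
    have "s \<bullet> u = (\<Sum>i\<in>UNIV. v $ i * (d i * x $ i))"
      unfolding inner_vec_def using d
      by (intro sum.cong refl) (simp add: s_def u_def)
    then have su: "s \<bullet> u = 0" using vx by (simp add: dx inner_vec_def)
    have "u \<bullet> (B *v u) = (\<Sum>i\<in>UNIV. v $ i * (sqrt (d i) * r i * (M *v v) $ i))"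
      unfolding inner_vec_def
      using scale[of v] by (intro sum.cong refl) (simp add: Bw u_def)
    also have "\<dots> = v \<bullet> (M *v v)"
      unfolding inner_vec_def rM by simp
    finally have uBu: "u \<bullet> (B *v u) > 0" using pos by simp
    have inv: "s \<bullet> (B *v y) = 0" if "s \<bullet> y = 0" for y
      using that Bs by (simp add: symmetric_matrix_inner[OF symB])
    obtain w l where w: "s \<bullet> w = 0" "w \<noteq> 0" "l > 0" "B *v w = l *\<^sub>R w"
      using symmetric_eigenvector_in_subspace[OF symB subspace_hyperplane[of s], of u] inv su uBu
      by auto
    define z :: "real^'n" where "z = (\<chi> i. r i * w $ i)"
    have lw: "r i * (M *v z) $ i = l * w $ i" for i
      using w(4) Bw[of w i] by (simp add: z_def)
    have w0: "w $ i = 0" if "d i = 0" for i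
      using lw[of i] that \<open>l > 0\<close> by (simp add: r_def)
    have wz: "w $ i = sqrt (d i) * z $ i" for i
      using w0[of i] d[of i] by (cases "d i = 0") (auto simp: z_def r_def)
    have Mz: "(M *v z) $ i = l * d i * z $ i" for i
    proof (cases "d i = 0")
      case True
      then show ?thesis using d0 by (simp add: matrix_vector_mult_def)
    next
      case False
      then have "d i > 0" using d[of i] by simp
      have "(M *v z) $ i = sqrt (d i) * (r i * (M *v z) $ i)"
        using \<open>d i > 0\<close> by (simp add: r_def)
      also have "\<dots> = l * (sqrt (d i) * sqrt (d i)) * z $ i"
        by (simp add: lw wz)
      finally show ?thesis using d by simp
    qed
    define N where "N = (\<Sum>i\<in>UNIV. d i * (z $ i)\<^sup>2)"
    have "N = w \<bullet> w"
      unfolding N_def inner_vec_def using d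
      by (intro sum.cong refl) (simp add: wz power2_eq_square)
    then have N: "N > 0" using w by simp
    have zMz: "z \<bullet> (M *v z) = l * N"
      by (simp add: inner_vec_def Mz N_def sum_distrib_left power2_eq_square algebra_simps)
    have "(\<Sum>i\<in>UNIV. x $ i * ((M *v z) $ i)\<^sup>2 / (M *v x) $ i) = l\<^sup>2 * N"
      unfolding N_def sum_distrib_left
    proof (intro sum.cong refl)
      fix i
      show "x $ i * ((M *v z) $ i)\<^sup>2 / (M *v x) $ i = l\<^sup>2 * (d i * (z $ i)\<^sup>2)"
        using x[of i] by (cases "d i = 0")
          (auto simp: Mz dx[symmetric] power2_eq_square)
    qed
    \<comment> \<open>Here \<open>M z = l D z\<close>, so both sides of \<open>key\<close> are
      multiples of \<open>N\<close>, the form of \<open>D\<close> at \<open>z\<close>; no eigenvalue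
      lies strictly between 0 and 1.\<close>
    then have "l * N \<le> l\<^sup>2 * N" using key[of z] zMz by simp
    then have "l \<ge> 1" using N \<open>l > 0\<close> by (simp add: power2_eq_square)
    let ?g = "\<lambda>i j. M $ i $ j * x $ i * x $ j * (z $ i / x $ i - z $ j / x $ j)\<^sup>2"
    have g: "?g i j \<ge> 0" for i j using nonneg x by (simp add: less_imp_le)
    \<comment> \<open>A sum of nonnegative terms equals \<open>2 N (1 - l) \<le> 0\<close>, so every
      term is zero and \<open>z / x\<close> is constant along the positive entries of
      \<open>M\<close>.\<close>
    have "(\<Sum>i\<in>UNIV. \<Sum>j\<in>UNIV. ?g i j) = 2 * (N - l * N)"
      unfolding symmetric_quadratic_gap[OF sym x] zMz N_def d_def ..
    also have "\<dots> \<le> 0" using N \<open>l \<ge> 1\<close> by simp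
    finally have "(\<Sum>i\<in>UNIV. \<Sum>j\<in>UNIV. ?g i j) = 0"
      using g by (intro antisym sum_nonneg) auto
    then have "?g i j = 0" for i j
      using g by (simp add: sum_nonneg_eq_0_iff sum_nonneg)
    then have edge: "z $ i / x $ i = z $ j / x $ j" if "M $ i $ j > 0" for i j
      using that x[of i] x[of j]
      by (metis less_irrefl mult_eq_0_iff power2_eq_square right_minus_eq)
    obtain i where i: "w $ i \<noteq> 0" using w by (auto simp: vec_eq_iff)
    have di: "d i > 0" using w0[of i] i d[of i] by (auto simp: less_le)
    define c where "c = z $ i / x $ i"
    \<comment> \<open>The level set of \<open>z / x\<close> through \<open>i\<close> is closed under
      positive entries of \<open>M\<close>; \<open>conn\<close> spreads it to all indices with
      \<open>d j > 0\<close>.\<close>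
    have c: "z $ j = c * x $ j" if "d j > 0" for j
    proof -
      have "j \<in> {k. z $ k / x $ k = c}"
      proof (rule conn)
        show "i \<in> {k. z $ k / x $ k = c}" by (simp add: c_def)
        show "(M *v x) $ i > 0" "(M *v x) $ j > 0" using di that x by (auto simp: dx[symmetric])
      qed (use edge in auto)
      then show ?thesis using x[of j] by (auto simp: field_simps)
    qed
    have "0 = (\<Sum>k\<in>UNIV. d k * x $ k * z $ k)"
    proof -
      have "s \<bullet> w = (\<Sum>k\<in>UNIV. d k * x $ k * z $ k)"
        unfolding inner_vec_def using d by (intro sum.cong refl) (simp add: s_def wz)
      then show ?thesis using w by simp
    qed
    also have "\<dots> = c * (\<Sum>k\<in>UNIV. d k * (x $ k)\<^sup>2)"
      unfolding sum_distrib_left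
    proof (intro sum.cong refl)
      fix k
      show "d k * x $ k * z $ k = c * (d k * (x $ k)\<^sup>2)"
        using c[of k] d[of k] by (cases "d k = 0") (auto simp: power2_eq_square)
    qed
    finally have "c * (\<Sum>k\<in>UNIV. d k * (x $ k)\<^sup>2) = 0" by simp
    moreover have "(\<Sum>k\<in>UNIV. d k * (x $ k)\<^sup>2) > 0"
      using d di x by (intro sum_pos2[of _ i]) (auto intro!: mult_pos_pos zero_less_power)
    moreover have "c \<noteq> 0" using i x[of i] by (auto simp: c_def wz)
    ultimately show False by simp
  qed
  show ?thesis
  proof (cases "x \<bullet> (M *v x) = 0")
    case False
    define q where "q = x \<bullet> (M *v x)"
    have q: "q > 0" using False Mx x
      by (auto simp: q_def inner_vec_def less_le intro!: sum_nonneg mult_nonneg_nonneg)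
    \<comment> \<open>Projection along \<open>x\<close> onto the hyperplane orthogonal to
      \<open>M x\<close>, where \<open>neg\<close> applies.\<close>
    define c where "c = (v \<bullet> (M *v x)) / q"
    have "(v - c *\<^sub>R x) \<bullet> (M *v x) = 0" using q by (simp add: c_def inner_simps q_def)
    from neg[OF this]
    have "v \<bullet> (M *v v) - 2 * c * (v \<bullet> (M *v x)) + c\<^sup>2 * q \<le> 0"
      using symmetric_matrix_inner[OF sym, of x v]
      by (simp add: matrix_vector_mult_diff_distrib matrix_vector_mult_scaleR inner_simps
          inner_commute algebra_simps power2_eq_square q_def)
    then have "v \<bullet> (M *v v) \<le> (v \<bullet> (M *v x))\<^sup>2 / q"
      using q by (simp add: c_def field_simps power2_eq_square)
    then show ?thesis using q by (simp add: field_simps q_def)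
  qed simp
qed

section \<open>Evaluation and derivatives of polynomials\<close>

definition monom_eval :: "('a::finite \<Rightarrow>\<^sub>0 nat) \<Rightarrow> real^'a \<Rightarrow> real" where
  "monom_eval n x = (\<Prod>a\<in>UNIV. x $ a ^ Poly_Mapping.lookup n a)"

definition poly_eval :: "'a::finite rpoly \<Rightarrow> real^'a \<Rightarrow> real" where
  "poly_eval f x = (\<Sum>n\<in>Poly_Mapping.keys f. Poly_Mapping.lookup f n * monom_eval n x)"

definition gradient :: "'a::finite rpoly \<Rightarrow> real^'a \<Rightarrow> real^'a" where
  "gradient f x = (\<chi> a. poly_eval (partial_deriv a f) x)"

definition hessian_at :: "'a::finite rpoly \<Rightarrow> real^'a \<Rightarrow> real^'a^'a" where
  "hessian_at f x = (\<chi> a b. poly_eval (partial_deriv a (partial_deriv b f)) x)"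

text \<open>With the degree as a parameter, the zero polynomial is homogeneous of every degree, so
  partial derivatives stay within the notion even when they vanish.\<close>

definition homogeneous_of_degree :: "nat \<Rightarrow> 'a::finite rpoly \<Rightarrow> bool" where
  "homogeneous_of_degree d f \<longleftrightarrow> (\<forall>n\<in>Poly_Mapping.keys f. monom_degree n = d)"

lemma poly_eval_superset:
  assumes "finite S" "Poly_Mapping.keys f \<subseteq> S"
  shows "poly_eval f x = (\<Sum>n\<in>S. Poly_Mapping.lookup f n * monom_eval n x)"
  unfolding poly_eval_def using assms
  by (intro sum.mono_neutral_left) (auto simp: in_keys_iff)

lemma poly_eval_zero [simp]: "poly_eval 0 x = 0"
  by (simp add: poly_eval_def)

lemma poly_eval_add: "poly_eval (f + g) x = poly_eval f x + poly_eval g x"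
proof -
  let ?S = "Poly_Mapping.keys f \<union> Poly_Mapping.keys g"
  have "poly_eval h x = (\<Sum>n\<in>?S. Poly_Mapping.lookup h n * monom_eval n x)"
    if "Poly_Mapping.keys h \<subseteq> ?S" for h
    using that by (intro poly_eval_superset) auto
  from this[of f] this[of g] this[of "f + g"] show ?thesis
    using keys_add[of f g] by (simp add: lookup_add distrib_right sum.distrib)
qed

lemma poly_eval_sum: "poly_eval (\<Sum>i\<in>I. F i) x = (\<Sum>i\<in>I. poly_eval (F i) x)"
  by (induction I rule: infinite_finite_induct) (auto simp: poly_eval_add)

lemma poly_eval_single: "poly_eval (Poly_Mapping.single n c) x = c * monom_eval n x"
  by (subst poly_eval_superset[of "{n}"]) auto

text \<open>Lowering the exponent of \<open>a\<close> is injective on exponents that contain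
  \<open>a\<close>, and the others carry the factor 0, so at most one summand contributes to each
  coefficient.\<close>

lemma lookup_partial_deriv:
  "Poly_Mapping.lookup (partial_deriv a f) n
     = real (Poly_Mapping.lookup n a + 1) * Poly_Mapping.lookup f (n + Poly_Mapping.single a 1)"
proof -
  let ?e = "Poly_Mapping.single a (1::nat)"
  have *: "k - ?e = n \<longleftrightarrow> k = n + ?e" if "Poly_Mapping.lookup k a > 0" for k
    using that by (auto simp: poly_mapping_eq_iff fun_eq_iff lookup_add lookup_minus lookup_single
        when_def split: if_splits)
  have "Poly_Mapping.lookup (partial_deriv a f) n
     = (\<Sum>k\<in>Poly_Mapping.keys f. if n + ?e = k
          then real (Poly_Mapping.lookup k a) * Poly_Mapping.lookup f k else 0)"
    unfolding partial_deriv_def lookup_sum lookup_single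
  proof (intro sum.cong refl)
    fix k
    show "(real (Poly_Mapping.lookup k a) * Poly_Mapping.lookup f k when k - ?e = n)
        = (if n + ?e = k then real (Poly_Mapping.lookup k a) * Poly_Mapping.lookup f k else 0)"
      using *[of k] by (cases "Poly_Mapping.lookup k a = 0") (auto simp: when_def)
  qed
  also have "\<dots> = real (Poly_Mapping.lookup (n + ?e) a) * Poly_Mapping.lookup f (n + ?e)"
    by (auto simp: in_keys_iff)
  finally show ?thesis by (simp add: lookup_add)
qed

lemma partial_deriv_commute: "partial_deriv a (partial_deriv b f) = partial_deriv b (partial_deriv a f)"
  by (rule poly_mapping_eqI)
    (auto simp: lookup_partial_deriv lookup_add lookup_single when_def ac_simps)

lemma partial_deriv_nonneg:
  assumes "\<And>n. Poly_Mapping.lookup f n \<ge> 0"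
  shows "Poly_Mapping.lookup (partial_deriv a f) n \<ge> 0"
  using assms by (simp add: lookup_partial_deriv)

lemma monom_degree_add_single:
  "monom_degree (n + Poly_Mapping.single a 1) = Suc (monom_degree n)"
  by (simp add: monom_degree_def lookup_add lookup_single sum.distrib when_def)

lemma homogeneous_partial_deriv:
  assumes "homogeneous_of_degree d f"
  shows "homogeneous_of_degree (d - 1) (partial_deriv a f)"
  unfolding homogeneous_of_degree_def
proof
  fix n assume "n \<in> Poly_Mapping.keys (partial_deriv a f)"
  then have "n + Poly_Mapping.single a 1 \<in> Poly_Mapping.keys f"
    by (auto simp: in_keys_iff lookup_partial_deriv)
  then show "monom_degree n = d - 1"
    using assms monom_degree_add_single[of n a] by (auto simp: homogeneous_of_degree_def)
qed

lemma partial_deriv_degree_0: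
  assumes "homogeneous_of_degree 0 f"
  shows "partial_deriv a f = 0"
proof (rule poly_mapping_eqI)
  fix n
  have "n + Poly_Mapping.single a 1 \<notin> Poly_Mapping.keys f"
    using assms monom_degree_add_single[of n a] by (auto simp: homogeneous_of_degree_def)
  then show "Poly_Mapping.lookup (partial_deriv a f) n = Poly_Mapping.lookup 0 n"
    by (simp add: lookup_partial_deriv in_keys_iff)
qed

lemma total_degree_eq:
  assumes "homogeneous_of_degree d f" "f \<noteq> 0"
  shows "total_degree f = d"
proof -
  have "monom_degree ` Poly_Mapping.keys f = {d}"
    using assms unfolding homogeneous_of_degree_def
    by (metis (no_types, lifting) image_cong image_constant keys_eq_empty ex_in_conv)
  then show ?thesis by (simp add: total_degree_def)
qed

lemma monom_eval_remove:
  "monom_eval n x = x $ a ^ Poly_Mapping.lookup n a * (\<Prod>b\<in>UNIV - {a}. x $ b ^ Poly_Mapping.lookup n b)"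
  unfolding monom_eval_def by (rule prod.remove) auto

lemma monom_eval_minus_single:
  "monom_eval (n - Poly_Mapping.single a 1) x
     = x $ a ^ (Poly_Mapping.lookup n a - 1) * (\<Prod>b\<in>UNIV - {a}. x $ b ^ Poly_Mapping.lookup n b)"
  unfolding monom_eval_remove[where a = a]
  by (auto simp: lookup_minus lookup_single when_def intro!: arg_cong2[of _ _ _ _ "(*)"] prod.cong)

lemma poly_eval_partial_deriv:
  "poly_eval (partial_deriv a f) x = (\<Sum>n\<in>Poly_Mapping.keys f. Poly_Mapping.lookup f n *
     (real (Poly_Mapping.lookup n a) * monom_eval (n - Poly_Mapping.single a 1) x))"
  by (simp add: partial_deriv_def poly_eval_sum poly_eval_single mult_ac)

lemma monom_eval_pos:
  assumes "\<And>a. x $ a > 0"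
  shows "monom_eval n x > 0"
  using assms by (auto simp: monom_eval_def intro!: prod_pos)

lemma poly_eval_nonneg:
  assumes "\<And>n. Poly_Mapping.lookup f n \<ge> 0" "\<And>a. x $ a > 0"
  shows "poly_eval f x \<ge> 0"
  unfolding poly_eval_def using assms monom_eval_pos[of x]
  by (intro sum_nonneg mult_nonneg_nonneg) (auto simp: less_imp_le)

text \<open>Nonnegative terms cannot cancel at a positive point. This translates positivity of
  gradient and Hessian entries into statements about supports.\<close>

lemma poly_eval_pos_iff:
  assumes "\<And>n. Poly_Mapping.lookup f n \<ge> 0" "\<And>a. x $ a > 0"
  shows "poly_eval f x > 0 \<longleftrightarrow> f \<noteq> 0"
proof
  assume "f \<noteq> 0"
  then obtain n where n: "n \<in> Poly_Mapping.keys f" by fastforce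
  then have "Poly_Mapping.lookup f n > 0"
    using assms(1)[of n] by (simp add: in_keys_iff)
  then show "poly_eval f x > 0"
    unfolding poly_eval_def using assms n monom_eval_pos[of x]
    by (intro sum_pos2[of _ n]) (auto simp: less_imp_le)
qed auto

lemma euler_homogeneous:
  assumes "homogeneous_of_degree d f"
  shows "(\<Sum>a\<in>UNIV. x $ a * poly_eval (partial_deriv a f) x) = real d * poly_eval f x"
proof -
  have *: "x $ a * (real (Poly_Mapping.lookup n a) * monom_eval (n - Poly_Mapping.single a 1) x)
     = real (Poly_Mapping.lookup n a) * monom_eval n x" for a n
    unfolding monom_eval_minus_single monom_eval_remove[of n x a]
    by (cases "Poly_Mapping.lookup n a") auto
  have "(\<Sum>a\<in>UNIV. x $ a * poly_eval (partial_deriv a f) x)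
     = (\<Sum>a\<in>UNIV. \<Sum>n\<in>Poly_Mapping.keys f.
          Poly_Mapping.lookup f n * (real (Poly_Mapping.lookup n a) * monom_eval n x))"
    unfolding poly_eval_partial_deriv sum_distrib_left *[symmetric]
    by (intro sum.cong refl) (simp add: mult_ac)
  also have "\<dots> = (\<Sum>n\<in>Poly_Mapping.keys f. \<Sum>a\<in>UNIV.
          Poly_Mapping.lookup f n * (real (Poly_Mapping.lookup n a) * monom_eval n x))"
    by (rule sum.swap)
  also have "\<dots> = (\<Sum>n\<in>Poly_Mapping.keys f. real (monom_degree n) * (Poly_Mapping.lookup f n * monom_eval n x))"
    by (simp add: monom_degree_def sum_distrib_left sum_distrib_right mult_ac)
  also have "\<dots> = real d * poly_eval f x"
    using assms by (simp add: poly_eval_def homogeneous_of_degree_def sum_distrib_left)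
  finally show ?thesis .
qed

lemma inner_gradient: "v \<bullet> gradient f x = (\<Sum>a\<in>UNIV. v $ a * poly_eval (partial_deriv a f) x)"
  by (simp add: inner_vec_def gradient_def)

lemma transpose_hessian_at: "transpose (hessian_at f x) = hessian_at f x"
  by (simp add: hessian_at_def transpose_def vec_eq_iff partial_deriv_commute)

lemma hessian_at_row: "(hessian_at f x *v v) $ a = v \<bullet> gradient (partial_deriv a f) x"
  unfolding hessian_at_def matrix_vector_mult_def inner_gradient
  by (simp add: mult.commute partial_deriv_commute[of a])

lemma hessian_at_euler:
  assumes "homogeneous_of_degree d f"
  shows "hessian_at f x *v x = real (d - 1) *\<^sub>R gradient f x"
proof -
  have "(hessian_at f x *v x) $ a = (real (d - 1) *\<^sub>R gradient f x) $ a" for a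
    unfolding hessian_at_row inner_gradient euler_homogeneous[OF homogeneous_partial_deriv[OF assms]]
    by (simp add: gradient_def)
  then show ?thesis by (simp add: vec_eq_iff)
qed

text \<open>Euler's identity for the second partial derivatives, which have degree
  \<open>d - 2\<close>. It is what adds the Hessian inequalities of all
  \<open>partial_deriv i f\<close> up to one for \<open>f\<close>.\<close>

lemma hessian_at_third_euler:
  assumes "homogeneous_of_degree d f"
  shows "(\<Sum>i\<in>UNIV. x $ i * (v \<bullet> (hessian_at (partial_deriv i f) x *v v)))
     = real (d - 2) * (v \<bullet> (hessian_at f x *v v))"
proof -
  have eq: "(\<Sum>i\<in>UNIV. x $ i * poly_eval (partial_deriv a (partial_deriv b (partial_deriv i f))) x)
     = real (d - 2) * poly_eval (partial_deriv a (partial_deriv b f)) x" for a b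
  proof -
    have "homogeneous_of_degree (d - 1 - 1) (partial_deriv a (partial_deriv b f))"
      by (intro homogeneous_partial_deriv assms)
    moreover have "partial_deriv a (partial_deriv b (partial_deriv i f))
        = partial_deriv i (partial_deriv a (partial_deriv b f))" for i
      by (metis partial_deriv_commute)
    ultimately show ?thesis
      using euler_homogeneous by (simp add: numeral_2_eq_2)
  qed
  have "(\<Sum>i\<in>UNIV. x $ i * (v \<bullet> (hessian_at (partial_deriv i f) x *v v)))
     = (\<Sum>i\<in>UNIV. \<Sum>a\<in>UNIV. \<Sum>b\<in>UNIV. v $ a * v $ b *
          (x $ i * poly_eval (partial_deriv a (partial_deriv b (partial_deriv i f))) x))"
    by (simp add: inner_vec_def matrix_vector_mult_def hessian_at_def sum_distrib_left mult_ac)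
  also have "\<dots> = (\<Sum>a\<in>UNIV. \<Sum>i\<in>UNIV. \<Sum>b\<in>UNIV. v $ a * v $ b *
          (x $ i * poly_eval (partial_deriv a (partial_deriv b (partial_deriv i f))) x))"
    by (rule sum.swap)
  also have "\<dots> = (\<Sum>a\<in>UNIV. \<Sum>b\<in>UNIV. \<Sum>i\<in>UNIV. v $ a * v $ b *
          (x $ i * poly_eval (partial_deriv a (partial_deriv b (partial_deriv i f))) x))"
    by (intro sum.cong refl sum.swap)
  also have "\<dots> = real (d - 2) * (v \<bullet> (hessian_at f x *v v))"
    unfolding sum_distrib_left[symmetric] eq
    by (simp add: inner_vec_def matrix_vector_mult_def hessian_at_def sum_distrib_left mult_ac)
  finally show ?thesis .
qed

lemma poly_eval_has_derivative:
  "((\<lambda>t. poly_eval f (y + t *\<^sub>R v)) has_real_derivative v \<bullet> gradient f (y + t *\<^sub>R v)) (at t)"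
proof -
  let ?z = "y + t *\<^sub>R v"
  have "((\<lambda>t. monom_eval n (y + t *\<^sub>R v)) has_real_derivative
     (\<Sum>a\<in>UNIV. v $ a * (real (Poly_Mapping.lookup n a) * monom_eval (n - Poly_Mapping.single a 1) ?z))) (at t)"
    for n
  proof -
    have "((\<lambda>t. \<Prod>a\<in>UNIV. (y $ a + t * v $ a) ^ Poly_Mapping.lookup n a) has_real_derivative
       (\<Sum>a\<in>UNIV. (real (Poly_Mapping.lookup n a) * v $ a * (y $ a + t * v $ a) ^ (Poly_Mapping.lookup n a - 1))
          * (\<Prod>b\<in>UNIV - {a}. (y $ b + t * v $ b) ^ Poly_Mapping.lookup n b))) (at t)"
      by (rule has_field_derivative_prod) (auto intro!: derivative_eq_intros)
    then show ?thesis
      unfolding monom_eval_minus_single by (simp add: monom_eval_def mult_ac)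
  qed
  then have "((\<lambda>t. poly_eval f (y + t *\<^sub>R v)) has_real_derivative
     (\<Sum>n\<in>Poly_Mapping.keys f. Poly_Mapping.lookup f n * (\<Sum>a\<in>UNIV. v $ a *
        (real (Poly_Mapping.lookup n a) * monom_eval (n - Poly_Mapping.single a 1) ?z)))) (at t)"
    unfolding poly_eval_def by (intro DERIV_sum DERIV_cmult)
  also have "(\<Sum>n\<in>Poly_Mapping.keys f. Poly_Mapping.lookup f n * (\<Sum>a\<in>UNIV. v $ a *
        (real (Poly_Mapping.lookup n a) * monom_eval (n - Poly_Mapping.single a 1) ?z)))
     = v \<bullet> gradient f ?z"
    unfolding inner_gradient poly_eval_partial_deriv sum_distrib_left
    by (subst sum.swap) (simp add: mult_ac)
  finally show ?thesis .
qed

lemma gradient_has_derivative: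
  "((\<lambda>t. v \<bullet> gradient f (y + t *\<^sub>R v)) has_real_derivative
      v \<bullet> (hessian_at f (y + t *\<^sub>R v) *v v)) (at t)"
  unfolding inner_gradient[of v f]
  by (auto intro!: derivative_eq_intros poly_eval_has_derivative
      simp: inner_vec_def[of v "hessian_at _ _ *v v"] hessian_at_row mult.commute)

text \<open>Variables sharing a monomial form a connected graph. If \<open>j\<close> were outside
  \<open>S\<close>, then \<alpha> would use only variables in \<open>S\<close> and \<beta> only
  variables outside. Exchanging one unit of \<open>i\<close> in \<alpha> for some \<tau> outside
  \<open>S\<close> leaves, as the degree is at least 2, a monomial using both kinds, against
  closedness.\<close>

lemma M_convex_connected:
  assumes K: "M_convex K" and deg: "\<And>\<alpha>. \<alpha> \<in> K \<Longrightarrow> monom_degree \<alpha> \<ge> 2"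
    and closed: "\<And>\<alpha> k l. \<lbrakk>\<alpha> \<in> K; k \<in> S; k \<noteq> l; Poly_Mapping.lookup \<alpha> k > 0;
        Poly_Mapping.lookup \<alpha> l > 0\<rbrakk> \<Longrightarrow> l \<in> S"
    and \<alpha>: "\<alpha> \<in> K" "i \<in> S" "Poly_Mapping.lookup \<alpha> i > 0"
    and \<beta>: "\<beta> \<in> K" "Poly_Mapping.lookup \<beta> j > 0"
  shows "j \<in> S"
proof (rule ccontr)
  assume "j \<notin> S"
  then have \<beta>0: "Poly_Mapping.lookup \<beta> k = 0" if "k \<in> S" for k
    using closed[of \<beta> k j] \<beta> that by auto
  have \<alpha>0: "Poly_Mapping.lookup \<alpha> k = 0" if "k \<notin> S" for k
    using closed[of \<alpha> i k] \<alpha> that by auto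
  obtain \<tau> where \<tau>: "Poly_Mapping.lookup \<alpha> \<tau> < Poly_Mapping.lookup \<beta> \<tau>"
    "\<alpha> - Poly_Mapping.single i 1 + Poly_Mapping.single \<tau> 1 \<in> K"
    using K \<alpha> \<beta> \<beta>0[of i] unfolding M_convex_def by metis
  let ?\<gamma> = "\<alpha> - Poly_Mapping.single i 1 + Poly_Mapping.single \<tau> (1::nat)"
  have "\<tau> \<notin> S" using \<tau>(1) \<beta>0 by auto
  have "\<exists>k\<in>S. Poly_Mapping.lookup ?\<gamma> k > 0"
  proof (rule ccontr)
    assume "\<not> ?thesis"
    then have *: "Poly_Mapping.lookup \<alpha> k - (if k = i then 1 else 0) = 0" if "k \<in> S" for k
      using that by (auto simp: lookup_add lookup_minus lookup_single when_def split: if_splits)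
    have "Poly_Mapping.lookup \<alpha> k \<le> (if k = i then 1 else 0)" for k
      using *[of k] \<alpha>0[of k] by (cases "k \<in> S") auto
    then have "monom_degree \<alpha> \<le> (\<Sum>k\<in>UNIV. if k = i then 1 else 0)"
      unfolding monom_degree_def by (intro sum_mono)
    with deg[OF \<alpha>(1)] show False by simp
  qed
  moreover have "Poly_Mapping.lookup ?\<gamma> \<tau> > 0" by (simp add: lookup_add)
  ultimately show False using closed[OF \<tau>(2), of _ \<tau>] \<open>\<tau> \<notin> S\<close> by metis
qed

section \<open>Log-concavity of Lorentzian polynomials\<close>

lemma partial_deriv_nonzero:
  assumes "Poly_Mapping.lookup f n \<noteq> 0" "Poly_Mapping.lookup n a > 0"
  shows "Poly_Mapping.lookup (partial_deriv a f) (n - Poly_Mapping.single a 1) \<noteq> 0"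
proof -
  have "n - Poly_Mapping.single a 1 + Poly_Mapping.single a 1 = n"
    using assms(2) by (auto simp: poly_mapping_eq_iff fun_eq_iff lookup_add lookup_minus lookup_single when_def)
  then show ?thesis using assms(1) by (simp add: lookup_partial_deriv)
qed

text \<open>By Euler's identities this is the reverse Cauchy-Schwarz inequality for the Hessian with
  \<open>x\<close> as reference vector. Degree 1 has zero Hessian, degree 2 is the antiferromagnetic
  base case, and from degree 3 on the inequality trickles down from the partial derivatives.\<close>

lemma lorentzian_reverse_Cauchy_Schwarz:
  fixes x :: "real^'a::finite"
  assumes f: "lorentzian f" "total_degree f \<ge> 1" and x: "\<And>a. x $ a > 0"
  shows "real (total_degree f) * poly_eval f x * (v \<bullet> (hessian_at f x *v v))
    \<le> (real (total_degree f) - 1) * (v \<bullet> gradient f x)\<^sup>2"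
  using f
proof (induction f arbitrary: v rule: lorentzian.induct)
  case (lorentzian_pos_degree f v)
  note nonneg = lorentzian_pos_degree(1)[rule_format]
  define d where "d = total_degree f"
  define M where "M = hessian_at f x"
  have d1: "d \<ge> 1" using lorentzian_pos_degree by (simp add: d_def)
  have hom: "homogeneous_of_degree d f"
    using lorentzian_pos_degree by (simp add: d_def homogeneous_def homogeneous_of_degree_def)
  have sym: "transpose M = M" by (simp add: M_def transpose_hessian_at)
  have M_entry: "M $ a $ b = poly_eval (partial_deriv a (partial_deriv b f)) x" for a b
    by (simp add: M_def hessian_at_def)
  have M_nonneg: "M $ a $ b \<ge> 0" for a b
    unfolding M_entry by (intro poly_eval_nonneg partial_deriv_nonneg nonneg x)
  have Mx: "M *v x = (real d - 1) *\<^sub>R gradient f x"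
    using hessian_at_euler[OF hom] d1 by (simp add: M_def of_nat_diff)
  have xMx: "x \<bullet> (M *v x) = (real d - 1) * (real d * poly_eval f x)"
    using euler_homogeneous[OF hom] by (simp add: Mx inner_gradient)
  have xMx_nonneg: "x \<bullet> (M *v x) \<ge> 0"
    unfolding xMx using d1 poly_eval_nonneg[OF nonneg x] by simp
  have "real d * poly_eval f x * (v \<bullet> (M *v v)) \<le> (real d - 1) * (v \<bullet> gradient f x)\<^sup>2"
  proof (cases "d = 1")
    case True
    have "M $ a $ b = 0" for a b
      using homogeneous_partial_deriv[OF hom, of b] True
      by (simp add: M_entry partial_deriv_degree_0)
    then have "M *v v = 0" by (simp add: matrix_vector_mult_def vec_eq_iff)
    with True show ?thesis by simp
  next
    case False
    with d1 have d2: "d \<ge> 2" by simp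
    \<comment> \<open>By \<open>Mx\<close> and \<open>xMx\<close> this is the goal multiplied by
      \<open>d - 1\<close>, positive in this case.\<close>
    have "(v \<bullet> (M *v v)) * (x \<bullet> (M *v x)) \<le> (v \<bullet> (M *v x))\<^sup>2"
    proof (cases "d = 2")
      case True
      \<comment> \<open>For a quadratic the second derivatives are constants, so the Hessian at
        \<open>x\<close> is the matrix \<open>hessian f\<close>.\<close>
      have "poly_eval g x = Poly_Mapping.lookup g 0" if "homogeneous_of_degree 0 g" for g :: "'a rpoly"
      proof -
        have "Poly_Mapping.keys g \<subseteq> {0}"
          using that by (auto simp: homogeneous_of_degree_def monom_degree_def poly_mapping_eq_iff fun_eq_iff)
        then show ?thesis
          by (subst poly_eval_superset[of "{0}"]) (auto simp: monom_eval_def)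
      qed
      moreover have "homogeneous_of_degree 0 (partial_deriv a (partial_deriv b f))" for a b
        using homogeneous_partial_deriv[OF homogeneous_partial_deriv[OF hom]] True
        by (simp add: numeral_2_eq_2)
      ultimately have "M = hessian f"
        by (simp add: M_entry hessian_def vec_eq_iff)
      then have "antiferromagnetic M" using lorentzian_pos_degree True by (simp add: d_def)
      from antiferromagnetic_reverse_Cauchy_Schwarz[OF this xMx_nonneg] show ?thesis .
    next
      case False
      with d2 have d3: "d \<ge> 3" by simp
      have Mx_i: "(M *v x) $ i = (real d - 1) * poly_eval (partial_deriv i f) x" for i
        by (simp add: Mx gradient_def)
      have Mx_pos: "(M *v x) $ i > 0 \<longleftrightarrow> partial_deriv i f \<noteq> 0" for i
        using d2 poly_eval_pos_iff[OF partial_deriv_nonneg[OF nonneg] x, of i]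
        by (simp add: Mx_i zero_less_mult_iff)
      show ?thesis
      proof (rule reverse_Cauchy_Schwarz_of_trickle_down[OF sym M_nonneg x])
        fix v
        let ?q = "\<lambda>i. v \<bullet> (hessian_at (partial_deriv i f) x *v v)"
        \<comment> \<open>The induction hypothesis for \<open>partial_deriv i f\<close>, of degree
          \<open>d - 1\<close>, divided by \<open>(M x)_i\<close> and multiplied by
          \<open>x_i\<close>. If that derivative is zero, both sides are 0, the right one because
          division by zero gives 0.\<close>
        have "x $ i * ?q i \<le> (real d - 2) * (x $ i * ((M *v v) $ i)\<^sup>2 / (M *v x) $ i)" for i
        proof (cases "partial_deriv i f = 0")
          case True
          have "hessian_at 0 x = 0"
            by (simp add: hessian_at_def vec_eq_iff partial_deriv_def)
          with True show ?thesis by (simp add: Mx_i)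
        next
          case False
          then have deg: "total_degree (partial_deriv i f) = d - 1"
            using total_degree_eq[OF homogeneous_partial_deriv[OF hom]] by simp
          have "(real d - 1) * poly_eval (partial_deriv i f) x * ?q i
            \<le> (real d - 2) * (v \<bullet> gradient (partial_deriv i f) x)\<^sup>2"
            using lorentzian_pos_degree(6) d3 False deg by (auto simp: d_def of_nat_diff)
          then have "(M *v x) $ i * ?q i \<le> (real d - 2) * ((M *v v) $ i)\<^sup>2"
            unfolding Mx_i by (simp add: M_def hessian_at_row)
          then have "?q i \<le> (real d - 2) * ((M *v v) $ i)\<^sup>2 / (M *v x) $ i"
            using False Mx_pos[of i] by (simp add: pos_le_divide_eq mult.commute)
          from mult_left_mono[OF this less_imp_le[OF x[of i]]] show ?thesis
            by (simp add: mult_ac)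
        qed
        then have "(\<Sum>i\<in>UNIV. x $ i * ?q i)
            \<le> (real d - 2) * (\<Sum>i\<in>UNIV. x $ i * ((M *v v) $ i)\<^sup>2 / (M *v x) $ i)"
          unfolding sum_distrib_left by (intro sum_mono)
        moreover have "(\<Sum>i\<in>UNIV. x $ i * ?q i) = (real d - 2) * (v \<bullet> (M *v v))"
          using hessian_at_third_euler[OF hom, of x v] d2 by (simp add: M_def of_nat_diff)
        ultimately show "v \<bullet> (M *v v) \<le> (\<Sum>i\<in>UNIV. x $ i * ((M *v v) $ i)\<^sup>2 / (M *v x) $ i)"
          using d3 by simp
      next
        fix S i j
        assume i: "i \<in> S" "(M *v x) $ i > 0" and j: "(M *v x) $ j > 0"
          and closed: "\<And>k l. k \<in> S \<Longrightarrow> M $ k $ l > 0 \<Longrightarrow> l \<in> S"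
        have mono: "\<exists>\<alpha>\<in>Poly_Mapping.keys f. Poly_Mapping.lookup \<alpha> k > 0"
          if "(M *v x) $ k > 0" for k
        proof -
          obtain n where "Poly_Mapping.lookup (partial_deriv k f) n \<noteq> 0"
            using \<open>(M *v x) $ k > 0\<close> Mx_pos[of k] by (metis lookup_zero poly_mapping_eqI)
          then show ?thesis
            by (intro bexI[of _ "n + Poly_Mapping.single k 1"])
              (auto simp: lookup_partial_deriv lookup_add in_keys_iff)
        qed
        obtain \<alpha> \<beta> where "\<alpha> \<in> Poly_Mapping.keys f" "Poly_Mapping.lookup \<alpha> i > 0"
          "\<beta> \<in> Poly_Mapping.keys f" "Poly_Mapping.lookup \<beta> j > 0"
          using mono[OF i(2)] mono[OF j] by auto
        \<comment> \<open>Differentiating by \<open>k\<close> and \<open>l\<close> does not kill a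
          monomial containing both, so the Hessian entry is positive.\<close>
        moreover have "l \<in> S" if "\<alpha> \<in> Poly_Mapping.keys f" "k \<in> S" "k \<noteq> l"
          "Poly_Mapping.lookup \<alpha> k > 0" "Poly_Mapping.lookup \<alpha> l > 0" for \<alpha> k l
        proof (rule closed[OF \<open>k \<in> S\<close>])
          have "Poly_Mapping.lookup (partial_deriv l f) (\<alpha> - Poly_Mapping.single l 1) \<noteq> 0"
            using that by (intro partial_deriv_nonzero) (auto simp: in_keys_iff)
          moreover have "Poly_Mapping.lookup (\<alpha> - Poly_Mapping.single l 1) k > 0"
            using that by (simp add: lookup_minus lookup_single when_def)
          ultimately have "partial_deriv k (partial_deriv l f) \<noteq> 0"
            by (metis lookup_zero partial_deriv_nonzero)
          then show "M $ k $ l > 0"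
            unfolding M_entry
            using poly_eval_pos_iff[OF partial_deriv_nonneg[OF partial_deriv_nonneg[OF nonneg]] x]
            by blast
        qed
        moreover have "monom_degree \<gamma> \<ge> 2" if "\<gamma> \<in> Poly_Mapping.keys f" for \<gamma>
          using hom d2 that by (simp add: homogeneous_of_degree_def)
        ultimately show "j \<in> S"
          using M_convex_connected[OF lorentzian_pos_degree(4)] i(1) by blast
      qed
    qed
    moreover have vMx: "v \<bullet> (M *v x) = (real d - 1) * (v \<bullet> gradient f x)" by (simp add: Mx)
    ultimately have "(real d - 1) * (real d * poly_eval f x * (v \<bullet> (M *v v)))
        \<le> (real d - 1) * ((real d - 1) * (v \<bullet> gradient f x)\<^sup>2)"
      unfolding xMx vMx by (simp add: power_mult_distrib power2_eq_square mult_ac)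
    then show ?thesis using d2 by (simp add: mult_le_cancel_left)
  qed
  then show ?case by (simp add: d_def M_def)
qed simp

text \<open>Along the segment from \<open>y\<close> to \<open>x\<close> the function \<open>ln f\<close> is concave and stationary at \<open>y\<close>.\<close>

lemma lorentzian_stationary_max:
  fixes x y :: "real^'a::finite"
  assumes f: "lorentzian f" "total_degree f \<ge> 1"
    and y: "\<And>a. y $ a > 0" and x: "\<And>a. x $ a \<ge> 0"
    and stat: "(x - y) \<bullet> gradient f y = 0"
  shows "poly_eval f x \<le> poly_eval f y"
proof -
  define v where "v = x - y"
  have nonneg: "Poly_Mapping.lookup f n \<ge> 0" for n
    using f by (auto elim: lorentzian.cases)
  have "f \<noteq> 0" using f by (auto simp: total_degree_def)
  let ?z = "\<lambda>t. y + t *\<^sub>R v"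
  define p where "p t = poly_eval f (?z t)" for t
  define p' where "p' t = v \<bullet> gradient f (?z t)" for t
  define p'' where "p'' t = v \<bullet> (hessian_at f (?z t) *v v)" for t
  \<comment> \<open>\<open>x\<close> may have zero coordinates, so positivity is guaranteed only for
    \<open>t < 1\<close>.\<close>
  have z: "?z t $ a > 0" if "0 \<le> t" "t < 1" for t a
  proof -
    have "?z t $ a = (1 - t) * y $ a + t * x $ a" by (simp add: v_def algebra_simps)
    then show ?thesis using that x[of a] y[of a] by (simp add: add_pos_nonneg)
  qed
  have p_pos: "p t > 0" if "0 \<le> t" "t < 1" for t
    using poly_eval_pos_iff[OF nonneg z[OF that]] \<open>f \<noteq> 0\<close> by (simp add: p_def)
  have dp: "(p has_real_derivative p' t) (at t)" for t
    unfolding p_def p'_def by (rule poly_eval_has_derivative)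
  have dp': "(p' has_real_derivative p'' t) (at t)" for t
    unfolding p'_def p''_def by (rule gradient_has_derivative)
  have conc: "p t * p'' t \<le> (p' t)\<^sup>2" if "0 \<le> t" "t < 1" for t
  proof -
    let ?d = "real (total_degree f)"
    have "?d * p t * p'' t \<le> (?d - 1) * (p' t)\<^sup>2"
      unfolding p_def p'_def p''_def
      by (rule lorentzian_reverse_Cauchy_Schwarz[OF f z[OF that]])
    also have "\<dots> \<le> ?d * (p' t)\<^sup>2" by (intro mult_right_mono) auto
    finally have "?d * (p t * p'' t) \<le> ?d * (p' t)\<^sup>2" by (simp add: mult_ac)
    then show ?thesis using f(2) by simp
  qed
  have p'_le: "p' t \<le> 0" if t: "0 \<le> t" "t < 1" for t
  proof -
    \<comment> \<open>The quotient is the derivative of \<open>ln p\<close>; by \<open>conc\<close>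
      it is nonincreasing, and stationarity makes it 0 at the start.\<close>
    have "p' t / p t \<le> p' 0 / p 0"
    proof (rule DERIV_nonpos_imp_nonincreasing[OF t(1)])
      fix s assume s: "0 \<le> s" "s \<le> t"
      then have s1: "s < 1" using t by simp
      have "((\<lambda>s. p' s / p s) has_real_derivative (p'' s * p s - p' s * p' s) / (p s * p s)) (at s)"
        using p_pos[OF s(1) s1] by (intro DERIV_divide dp dp') auto
      moreover have "(p'' s * p s - p' s * p' s) / (p s * p s) \<le> 0"
        using conc[OF s(1) s1] by (intro divide_nonpos_nonneg) (auto simp: power2_eq_square mult.commute)
      ultimately show "\<exists>l. ((\<lambda>s. p' s / p s) has_real_derivative l) (at s) \<and> l \<le> 0" by blast
    qed
    also have "p' 0 = 0" using stat by (simp add: p'_def v_def)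
    finally show ?thesis using p_pos[OF t] by (simp add: divide_le_0_iff)
  qed
  have "p 1 \<le> p 0"
  proof (rule ccontr)
    assume gt: "\<not> p 1 \<le> p 0"
    \<comment> \<open>The mean value theorem needs the sign of \<open>p'\<close> only in the open
      interval, which covers the endpoint \<open>t = 1\<close>, where \<open>x\<close> may lie on
      the boundary of the orthant.\<close>
    have "continuous_on {0..1} p"
      using dp by (meson DERIV_isCont continuous_at_imp_continuous_on)
    then obtain l t where t: "0 < t" "t < 1" "(p has_real_derivative l) (at t)" "p 1 - p 0 = (1 - 0) * l"
      using MVT[of 0 1 p] dp by (auto simp: real_differentiable_def)
    then have "l = p' t" using dp DERIV_unique by blast
    then show False using t p'_le[of t] gt by simp
  qed
  then show ?thesis by (simp add: p_def v_def)
qed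

section \<open>Exchangeable laws\<close>

lemma finite_set_pmf_law:
  assumes "law_on_power m (\<mu> :: 'a::finite list pmf)"
  shows "finite (set_pmf \<mu>)"
proof (rule finite_subset)
  show "set_pmf \<mu> \<subseteq> {w. set w \<subseteq> UNIV \<and> length w = m}"
    using assms by (simp add: law_on_power_def)
  show "finite {w :: 'a list. set w \<subseteq> UNIV \<and> length w = m}"
    by (rule finite_lists_length_eq) simp
qed

text \<open>Swapping positions 0 and \<open>j\<close> preserves the law and turns the head into the
  letter at \<open>j\<close>.\<close>

lemma exchangeable_marginal:
  assumes "law_on_power m \<mu>" "exchangeable m \<mu>" "j < m"
  shows "map_pmf (\<lambda>w. w ! j) \<mu> = first_marginal \<mu>"
proof -
  let ?\<pi> = "Transposition.transpose 0 j"
  have perm: "?\<pi> permutes {..<m}" using assms by (intro permutes_swap_id) auto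
  then have "first_marginal \<mu> = map_pmf hd (map_pmf (permute_list ?\<pi>) \<mu>)"
    using assms by (simp add: first_marginal_def exchangeable_def)
  also have "\<dots> = map_pmf (\<lambda>w. w ! j) \<mu>"
    unfolding pmf.map_comp
  proof (intro map_pmf_cong refl)
    fix w assume "w \<in> set_pmf \<mu>"
    then have "length w = m" using assms by (auto simp: law_on_power_def)
    then show "(hd \<circ> permute_list ?\<pi>) w = w ! j"
      using assms(3) perm by (subst comp_apply, subst hd_conv_nth)
        (auto simp: permute_list_nth simp flip: length_greater_0_conv)
  qed
  finally show ?thesis ..
qed

lemma exchangeable_expectation:
  assumes "law_on_power m \<mu>" "exchangeable m \<mu>"
  shows "(\<Sum>w\<in>set_pmf \<mu>. pmf \<mu> w * (\<Sum>j<m. g (w ! j)))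
    = real m * (\<Sum>a\<in>UNIV. pmf (first_marginal \<mu>) a * g a)"
proof -
  have "(\<Sum>w\<in>set_pmf \<mu>. pmf \<mu> w * g (w ! j)) = (\<Sum>a\<in>UNIV. pmf (first_marginal \<mu>) a * g a)"
    if "j < m" for j
  proof -
    have "(\<Sum>w\<in>set_pmf \<mu>. pmf \<mu> w * g (w ! j)) = measure_pmf.expectation \<mu> (\<lambda>w. g (w ! j))"
      by (subst integral_measure_pmf_real[OF finite_set_pmf_law[OF assms(1)]])
        (auto simp: mult.commute)
    also have "\<dots> = measure_pmf.expectation (first_marginal \<mu>) g"
      unfolding exchangeable_marginal[OF assms that, symmetric] by (rule integral_map_pmf[symmetric])
    also have "\<dots> = (\<Sum>a\<in>UNIV. pmf (first_marginal \<mu>) a * g a)"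
      by (subst integral_measure_pmf_real[of UNIV]) (auto simp: mult.commute)
    finally show ?thesis .
  qed
  then show ?thesis
    by (simp add: sum_distrib_left sum.swap[of _ "{..<m}"])
qed

section \<open>Count-generating polynomials of laws\<close>

lemma monom_eval_count_vector: "monom_eval (count_vector w) x = (\<Prod>j<length w. x $ (w ! j))"
proof -
  have "monom_eval (count_vector w) x
      = (\<Prod>a\<in>UNIV. \<Prod>j\<in>{j\<in>{..<length w}. w ! j = a}. x $ (w ! j))"
    by (auto simp: monom_eval_def count_vector.rep_eq intro!: prod.cong)
  also have "\<dots> = (\<Prod>j<length w. x $ (w ! j))"
    by (rule prod.group) auto
  finally show ?thesis .
qed

lemma monom_degree_count_vector: "monom_degree (count_vector w) = length w"
proof -
  have "monom_degree (count_vector w) = (\<Sum>a\<in>UNIV. \<Sum>j\<in>{j\<in>{..<length w}. w ! j = a}. 1)"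
    by (simp add: monom_degree_def count_vector.rep_eq)
  also have "\<dots> = (\<Sum>j<length w. 1)"
    by (rule sum.group) auto
  finally show ?thesis by simp
qed

lemma poly_eval_count_gen_poly:
  assumes "law_on_power m \<nu>"
  shows "poly_eval (count_gen_poly \<nu>) x = (\<Sum>w\<in>set_pmf \<nu>. pmf \<nu> w * (\<Prod>j<m. x $ (w ! j)))"
  using assms by (auto simp: count_gen_poly_def poly_eval_sum poly_eval_single
      monom_eval_count_vector law_on_power_def intro!: sum.cong)

lemma homogeneous_count_gen_poly:
  assumes "law_on_power m \<nu>"
  shows "homogeneous_of_degree m (count_gen_poly \<nu>)"
  unfolding homogeneous_of_degree_def
proof
  fix n assume "n \<in> Poly_Mapping.keys (count_gen_poly \<nu>)"
  then have "n \<in> count_vector ` set_pmf \<nu>"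
    unfolding count_gen_poly_def using keys_sum by (force split: if_splits)
  then show "monom_degree n = m"
    using assms by (auto simp: monom_degree_count_vector law_on_power_def)
qed

text \<open>The product form of the generating function is differentiated directly at the all-ones
  point; uniqueness of derivatives identifies the result with the gradient.\<close>

lemma gradient_count_gen_poly:
  assumes "law_on_power m \<nu>" "exchangeable m \<nu>"
  shows "v \<bullet> gradient (count_gen_poly \<nu>) (\<chi> a. 1)
    = real m * (\<Sum>a\<in>UNIV. pmf (first_marginal \<nu>) a * v $ a)"
proof -
  have "((\<lambda>t. \<Prod>j<m. 1 + t * v $ (w ! j)) has_real_derivative (\<Sum>j<m. v $ (w ! j))) (at 0)" for w
  proof -
    have "((\<lambda>t. \<Prod>j<m. 1 + t * v $ (w ! j)) has_real_derivative
       (\<Sum>j<m. v $ (w ! j) * (\<Prod>k\<in>{..<m} - {j}. 1 + 0 * v $ (w ! k)))) (at 0)"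
      by (rule has_field_derivative_prod) (auto intro!: derivative_eq_intros)
    then show ?thesis by simp
  qed
  then have "((\<lambda>t. poly_eval (count_gen_poly \<nu>) ((\<chi> a. 1) + t *\<^sub>R v)) has_real_derivative
      (\<Sum>w\<in>set_pmf \<nu>. pmf \<nu> w * (\<Sum>j<m. v $ (w ! j)))) (at 0)"
    unfolding poly_eval_count_gen_poly[OF assms(1)]
    by (simp, intro DERIV_sum DERIV_cmult)
  with poly_eval_has_derivative[of "count_gen_poly \<nu>" "\<chi> a. 1" v 0]
  show ?thesis using DERIV_unique exchangeable_expectation[OF assms, of "($) v"] by fastforce
qed

section \<open>From log-concavity to relative entropy\<close>

theorem lemma3p5:
  fixes \<mu> \<nu> :: "'a::finite list pmf" and m :: nat
  assumes "m \<ge> 1"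
    and "law_on_power m \<mu>" and "exchangeable m \<mu>"
    and "law_on_power m \<nu>" and "exchangeable m \<nu>"
    and "lorentzian_law \<nu>"
  shows "rel_entropy (first_marginal \<mu>) (first_marginal \<nu>)
           \<le> ereal (1 / real m) * rel_entropy \<mu> \<nu>"
proof (cases "\<forall>w. pmf \<nu> w = 0 \<longrightarrow> pmf \<mu> w = 0")
  case False
  then have "rel_entropy \<mu> \<nu> = \<infinity>" by (simp add: rel_entropy_def)
  then show ?thesis using \<open>m \<ge> 1\<close> by simp
next
  case True
  let ?p = "pmf (first_marginal \<mu>)" and ?q = "pmf (first_marginal \<nu>)" and ?h = "count_gen_poly \<nu>"
  have sub: "set_pmf \<mu> \<subseteq> set_pmf \<nu>" using True by (auto simp: set_pmf_iff)
  then have "set_pmf (first_marginal \<mu>) \<subseteq> set_pmf (first_marginal \<nu>)"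
    by (auto simp: first_marginal_def)
  then have pq: "?q a = 0 \<Longrightarrow> ?p a = 0" for a by (auto simp: set_pmf_iff)
  note fin = finite_set_pmf_law[OF assms(2)] finite_set_pmf_law[OF assms(4)]
  \<comment> \<open>Where \<open>?q a = 0\<close> this coordinate is 0 by the convention for
    division, consistent with \<open>pq\<close>.\<close>
  define x :: "real^'a" where "x = (\<chi> a. ?p a / ?q a)"
  define g where "g w = (\<Prod>j<m. x $ (w ! j))" for w
  have h1: "poly_eval ?h (\<chi> a. 1) = 1"
    using fin by (simp add: poly_eval_count_gen_poly[OF assms(4)] sum_pmf_eq_1)
  then have "?h \<noteq> 0" by auto
  then have deg: "total_degree ?h = m"
    using total_degree_eq homogeneous_count_gen_poly[OF assms(4)] by blast
  \<comment> \<open>The term for \<open>a\<close> is \<open>?q a * (?p a / ?q a - 1)\<close>, which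
    equals \<open>?p a - ?q a\<close> thanks to \<open>pq\<close>. Both marginals have mass 1, so
    the sum vanishes.\<close>
  have "(x - (\<chi> a. 1)) \<bullet> gradient ?h (\<chi> a. 1) = real m * (\<Sum>a\<in>UNIV. ?p a - ?q a)"
    unfolding gradient_count_gen_poly[OF assms(4,5)]
    using pq by (intro arg_cong[of _ _ "(*) (real m)"] sum.cong refl)
      (auto simp: x_def field_simps)
  also have "\<dots> = 0" by (simp add: sum_subtractf sum_pmf_eq_1)
  finally have "poly_eval ?h x \<le> poly_eval ?h (\<chi> a. 1)"
    using assms(1,6) deg
    by (intro lorentzian_stationary_max) (auto simp: lorentzian_law_def x_def)
  then have hx: "(\<Sum>w\<in>set_pmf \<nu>. pmf \<nu> w * g w) \<le> 1"
    unfolding h1 by (simp add: poly_eval_count_gen_poly[OF assms(4)] g_def)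
  have x0: "x $ (w ! j) > 0" if "w \<in> set_pmf \<mu>" "j < m" for w j
  proof -
    have "w ! j \<in> set_pmf (first_marginal \<mu>)"
      using that unfolding exchangeable_marginal[OF assms(2,3) \<open>j < m\<close>, symmetric] by auto
    then have "?p (w ! j) > 0" by (simp add: pmf_positive)
    moreover from this have "?q (w ! j) > 0" using pq[of "w ! j"] by (auto simp: less_le)
    ultimately show ?thesis by (simp add: x_def)
  qed
  have g_nonneg: "g w \<ge> 0" for w by (auto simp: g_def x_def intro!: prod_nonneg)
  \<comment> \<open>Donsker-Varadhan in linearised form: for each \<open>w\<close>, apply
    \<open>ln s \<le> s - 1\<close> to \<open>s = pmf \<nu> w * g w / pmf \<mu> w\<close>. The
    logarithm of \<open>g w\<close> splits over positions because \<open>x0\<close> makes all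
    factors positive on the support of \<mu>.\<close>
  have "(\<Sum>w\<in>set_pmf \<mu>. pmf \<mu> w * (\<Sum>j<m. ln (x $ (w ! j))) - pmf \<mu> w * ln (pmf \<mu> w / pmf \<nu> w))
      \<le> (\<Sum>w\<in>set_pmf \<mu>. pmf \<nu> w * g w - pmf \<mu> w)"
  proof (rule sum_mono)
    fix w assume w: "w \<in> set_pmf \<mu>"
    then have pos: "pmf \<mu> w > 0" "pmf \<nu> w > 0" using sub by (auto simp: pmf_positive)
    have g: "g w > 0" using x0[OF w] by (auto simp: g_def intro!: prod_pos)
    have "ln (g w) = (\<Sum>j<m. ln (x $ (w ! j)))"
      unfolding g_def using x0[OF w] by (intro ln_prod) (simp_all add: less_imp_neq[THEN not_sym])
    then have "(\<Sum>j<m. ln (x $ (w ! j))) - ln (pmf \<mu> w / pmf \<nu> w) = ln (pmf \<nu> w * g w / pmf \<mu> w)"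
      using pos g by (simp add: ln_mult ln_div)
    also have "\<dots> \<le> pmf \<nu> w * g w / pmf \<mu> w - 1"
      using pos g by (intro ln_le_minus_one) simp
    finally have "pmf \<mu> w * ((\<Sum>j<m. ln (x $ (w ! j))) - ln (pmf \<mu> w / pmf \<nu> w))
        \<le> pmf \<mu> w * (pmf \<nu> w * g w / pmf \<mu> w - 1)"
      using pos by (intro mult_left_mono) auto
    then show "pmf \<mu> w * (\<Sum>j<m. ln (x $ (w ! j))) - pmf \<mu> w * ln (pmf \<mu> w / pmf \<nu> w)
        \<le> pmf \<nu> w * g w - pmf \<mu> w"
      using pos by (simp add: right_diff_distrib)
  qed
  also have "\<dots> = (\<Sum>w\<in>set_pmf \<mu>. pmf \<nu> w * g w) - 1"
    using fin by (simp add: sum_subtractf sum_pmf_eq_1)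
  \<comment> \<open>Enlarging the sum to the support of \<nu> produces the value of
    \<open>?h\<close> at \<open>x\<close>, which \<open>hx\<close> bounds by 1 and so cancels the
    \<open>- 1\<close>.\<close>
  also have "(\<Sum>w\<in>set_pmf \<mu>. pmf \<nu> w * g w) \<le> (\<Sum>w\<in>set_pmf \<nu>. pmf \<nu> w * g w)"
    using sub fin g_nonneg by (intro sum_mono2) auto
  finally have "(\<Sum>w\<in>set_pmf \<mu>. pmf \<mu> w * (\<Sum>j<m. ln (x $ (w ! j))))
      \<le> (\<Sum>w\<in>set_pmf \<mu>. pmf \<mu> w * ln (pmf \<mu> w / pmf \<nu> w))"
    using hx by (simp add: sum_subtractf)
  then have "real m * (\<Sum>a\<in>UNIV. ?p a * ln (x $ a)) \<le> (\<Sum>w\<in>set_pmf \<mu>. pmf \<mu> w * ln (pmf \<mu> w / pmf \<nu> w))"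
    using exchangeable_expectation[OF assms(2,3), of "\<lambda>a. ln (x $ a)"] by simp
  moreover have "(\<Sum>a\<in>UNIV. ?p a * ln (x $ a)) = (\<Sum>a\<in>set_pmf (first_marginal \<mu>). ?p a * ln (?p a / ?q a))"
    by (intro sum.mono_neutral_cong_right) (auto simp: set_pmf_iff x_def)
  ultimately show ?thesis
    using True pq \<open>m \<ge> 1\<close> by (simp add: rel_entropy_def field_simps)
qed

end
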